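(* Let $\mathcal{V}$ be a variety of algebras defined by a set of linear identities, let $\mathcal{A}=(A,F)\in\mathcal{V}$, and let $T$ be a tolerance of $\mathcal{A}$. Then there exist an algebra $\mathcal{B}\in\mathcal{V}$, a congruence $\boldsymbol{\theta}$ of $\mathcal{B}$, and a surjective homomorphism $\varphi\colon\mathcal{B}\to\mathcal{A}$ such that $T=\varphi(\boldsymbol{\theta})$, where $\varphi(\boldsymbol{\theta})=\{(\varphi(x),\varphi(y)) : (x,y)\in\boldsymbol{\theta}\}$.
   Context: Algebras are understood in the sense of universal algebra: an algebra $\mathcal{A}=(A,F)$ consists of a set $A$ together with a family $F$ of finitary basic operations on $A$ of a given signature. A variety defined by a set $\Sigma$ of identities is the class of all algebras of the given signature that satisfy every identity in $\Sigma$. An identity $s=t$ (where $s$ and $t$ are terms of the signature) is called linear if each variable occurs at most once in $s$ and at most once in $t$. (A variable may occur in only one of the two terms. The set of linear identities defining the variety may be empty.) A tolerance of an algebra $\mathcal{A}=(A,F)$ is a binary relation $T\subseteq A\times A$ that is reflexive, symmetric, and compatible with all basic operations. Compatibility means that for every $n$-ary basic operation $f\in F$, if $(a_i,b_i)\in T$ for $i=1,\dots,n$, then $(f(a_1,\dots,a_n),f(b_1,\dots,b_n))\in T$. A congruence is a transitive tolerance, i.e. a compatible equivalence relation. *)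

theory Defs
  imports Main
begin

(* The symbols form an explicit set, rather than the whole type 'f, so that the
   empty signature is included. *)
record 'f signature =
  syms :: "'f set"
  arity :: "'f \<Rightarrow> nat"

(* An operation is a function on argument lists; only its values on lists of
   carrier elements whose length is the arity of the symbol are relevant. *)
record ('a, 'f) algebra =
  carrier :: "'a set"
  oper :: "'f \<Rightarrow> 'a list \<Rightarrow> 'a"

definition args :: "'f signature \<Rightarrow> 'f \<Rightarrow> 'a set \<Rightarrow> 'a list set" where
  "args S f A = {xs. length xs = arity S f \<and> set xs \<subseteq> A}"

(* The empty carrier is admitted if there are no nullary symbols. *)
definition is_algebra :: "'f signature \<Rightarrow> ('a, 'f) algebra \<Rightarrow> bool" where
  "is_algebra S \<A> \<longleftrightarrow>
     (\<forall>f\<in>syms S. \<forall>xs\<in>args S f (carrier \<A>). oper \<A> f xs \<in> carrier \<A>)"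

datatype ('f, 'v) trm = Var 'v | App 'f "('f, 'v) trm list"

fun wf_trm :: "'f signature \<Rightarrow> ('f, 'v) trm \<Rightarrow> bool" where
  "wf_trm S (Var x) = True"
| "wf_trm S (App f ts) =
     (f \<in> syms S \<and> length ts = arity S f \<and> (\<forall>t\<in>set ts. wf_trm S t))"

(* The list of variable occurrences, with repetitions. *)
fun var_occs :: "('f, 'v) trm \<Rightarrow> 'v list" where
  "var_occs (Var x) = [x]"
| "var_occs (App f ts) = concat (map var_occs ts)"

fun eval_trm :: "('a, 'f) algebra \<Rightarrow> ('v \<Rightarrow> 'a) \<Rightarrow> ('f, 'v) trm \<Rightarrow> 'a" where
  "eval_trm \<A> \<rho> (Var x) = \<rho> x"
| "eval_trm \<A> \<rho> (App f ts) = oper \<A> f (map (eval_trm \<A> \<rho>) ts)"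

type_synonym ('f, 'v) identity = "('f, 'v) trm \<times> ('f, 'v) trm"

definition is_identity :: "'f signature \<Rightarrow> ('f, 'v) identity \<Rightarrow> bool" where
  "is_identity S e \<longleftrightarrow> wf_trm S (fst e) \<and> wf_trm S (snd e)"

definition linear_identity :: "('f, 'v) identity \<Rightarrow> bool" where
  "linear_identity e \<longleftrightarrow> distinct (var_occs (fst e)) \<and> distinct (var_occs (snd e))"

definition satisfies :: "('a, 'f) algebra \<Rightarrow> ('f, 'v) identity \<Rightarrow> bool" where
  "satisfies \<A> e \<longleftrightarrow>
     (\<forall>\<rho>. range \<rho> \<subseteq> carrier \<A> \<longrightarrow> eval_trm \<A> \<rho> (fst e) = eval_trm \<A> \<rho> (snd e))"

(* The members of the variety with elements in the type 'a. *)
definition variety :: "'f signature \<Rightarrow> ('f, 'v) identity set \<Rightarrow> ('a, 'f) algebra set" where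
  "variety S \<Sigma> = {\<A>. is_algebra S \<A> \<and> (\<forall>e\<in>\<Sigma>. satisfies \<A> e)}"

definition compatible :: "'f signature \<Rightarrow> ('a, 'f) algebra \<Rightarrow> ('a \<times> 'a) set \<Rightarrow> bool" where
  "compatible S \<A> T \<longleftrightarrow>
     (\<forall>f\<in>syms S. \<forall>xs\<in>args S f (carrier \<A>). \<forall>ys\<in>args S f (carrier \<A>).
        (\<forall>i<arity S f. (xs ! i, ys ! i) \<in> T) \<longrightarrow> (oper \<A> f xs, oper \<A> f ys) \<in> T)"

definition tolerance :: "'f signature \<Rightarrow> ('a, 'f) algebra \<Rightarrow> ('a \<times> 'a) set \<Rightarrow> bool" where
  "tolerance S \<A> T \<longleftrightarrow>
     T \<subseteq> carrier \<A> \<times> carrier \<A> \<and> refl_on (carrier \<A>) T \<and> sym T \<and> compatible S \<A> T"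

definition congruence :: "'f signature \<Rightarrow> ('a, 'f) algebra \<Rightarrow> ('a \<times> 'a) set \<Rightarrow> bool" where
  "congruence S \<A> \<theta> \<longleftrightarrow> tolerance S \<A> \<theta> \<and> trans \<theta>"

definition homomorphism ::
  "'f signature \<Rightarrow> ('b, 'f) algebra \<Rightarrow> ('a, 'f) algebra \<Rightarrow> ('b \<Rightarrow> 'a) \<Rightarrow> bool" where
  "homomorphism S \<B> \<A> \<phi> \<longleftrightarrow>
     \<phi> ` carrier \<B> \<subseteq> carrier \<A> \<and>
     (\<forall>f\<in>syms S. \<forall>xs\<in>args S f (carrier \<B>).
        \<phi> (oper \<B> f xs) = oper \<A> f (map \<phi> xs))"

definition rel_image :: "('b \<Rightarrow> 'a) \<Rightarrow> ('b \<times> 'b) set \<Rightarrow> ('a \<times> 'a) set" where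
  "rel_image \<phi> \<theta> = {(\<phi> x, \<phi> y) | x y. (x, y) \<in> \<theta>}"

(* HOL has no existential quantifier over types, so a statement that asserts the
   existence of an algebra has to name a type that contains its elements.  For
   algebras constructed from one with elements in 'a, the following type is used.
   It only bounds the size: the carrier may be any subset of it. *)
type_synonym 'a ext = "'a \<times> 'a set"

end

theory Submission
  imports Defs
begin

text \<open>Let \<open>\<B>\<close> consist of the pairs \<open>(a, X)\<close> where \<open>X\<close> is a clique of \<open>T\<close> and \<open>a \<in> X\<close>, with the
  operations of \<open>\<A>\<close> in the first component and their elementwise extensions to sets in the second.
  On nonempty sets a linear term is evaluated elementwise, since its variables can be chosen
  independently; hence linear identities pass from \<open>\<A>\<close> to \<open>\<B>\<close>. The map \<open>\<phi>\<close> is the first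
  projection and \<open>\<theta>\<close> is the kernel of the second: \<open>(a, b) \<in> T\<close> holds iff \<open>a\<close> and \<open>b\<close> lie in a
  common clique, for instance in \<open>{a, b}\<close>.\<close>

definition complex_algebra :: "('a, 'f) algebra \<Rightarrow> ('a set, 'f) algebra" where
  "complex_algebra \<A> =
     \<lparr>carrier = Pow (carrier \<A>),
      oper = (\<lambda>f Xs. {oper \<A> f xs | xs. list_all2 (\<in>) xs Xs})\<rparr>"

definition clique :: "('a \<times> 'a) set \<Rightarrow> 'a set \<Rightarrow> bool" where
  "clique T X \<longleftrightarrow> X \<times> X \<subseteq> T"

text \<open>The condition \<open>a \<in> X\<close> makes every second component nonempty, as the
  evaluation of terms on sets requires.\<close>

definition clique_algebra :: "('a, 'f) algebra \<Rightarrow> ('a \<times> 'a) set \<Rightarrow> ('a ext, 'f) algebra" where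
  "clique_algebra \<A> T =
     \<lparr>carrier = {(a, X). a \<in> X \<and> clique T X},
      oper = (\<lambda>f ps. (oper \<A> f (map fst ps), oper (complex_algebra \<A>) f (map snd ps)))\<rparr>"

lemma eval_trm_cong:
  assumes "\<And>v. v \<in> set (var_occs t) \<Longrightarrow> \<rho> v = \<sigma> v"
  shows "eval_trm \<A> \<rho> t = eval_trm \<A> \<sigma> t"
  using assms
proof (induction t)
  case (App f ts)
  then have "map (eval_trm \<A> \<rho>) ts = map (eval_trm \<A> \<sigma>) ts"
    by auto
  then show ?case
    by (simp only: eval_trm.simps)
qed simp

text \<open>Distinctness of the concatenated occurrences means that different terms of the list
  share no variable, so valuations chosen separately for each term can be glued into one.\<close>

lemma common_valuation:
  assumes "distinct (concat (map var_occs ts))"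
    and "\<And>v. R v \<noteq> {}"
    and "list_all2 (\<lambda>x t. \<exists>\<rho>. (\<forall>v. \<rho> v \<in> R v) \<and> x = eval_trm \<A> \<rho> t) xs ts"
  shows "\<exists>\<rho>. (\<forall>v. \<rho> v \<in> R v) \<and> xs = map (eval_trm \<A> \<rho>) ts"
  using assms(3,1)
proof (induction rule: list_all2_induct)
  case Nil
  show ?case
    using assms(2) by (intro exI[of _ "\<lambda>v. SOME a. a \<in> R v"]) (simp add: some_in_eq)
next
  case (Cons x xs t ts)
  obtain \<rho> where \<rho>: "\<forall>v. \<rho> v \<in> R v" "x = eval_trm \<A> \<rho> t"
    using Cons.hyps by blast
  obtain \<sigma> where \<sigma>: "\<forall>v. \<sigma> v \<in> R v" "xs = map (eval_trm \<A> \<sigma>) ts"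
    using Cons.IH Cons.prems by auto
  \<comment> \<open>The variables of \<open>t\<close> do not occur in \<open>ts\<close>, so
    overriding \<open>\<sigma>\<close> there leaves the values of \<open>ts\<close>
    unchanged.\<close>
  define \<tau> where "\<tau> v = (if v \<in> set (var_occs t) then \<rho> v else \<sigma> v)" for v
  have "eval_trm \<A> \<tau> t = eval_trm \<A> \<rho> t"
    by (rule eval_trm_cong) (simp add: \<tau>_def)
  moreover have "eval_trm \<A> \<tau> u = eval_trm \<A> \<sigma> u" if "u \<in> set ts" for u
    using that Cons.prems by (intro eval_trm_cong) (auto simp: \<tau>_def)
  ultimately have "x # xs = map (eval_trm \<A> \<tau>) (t # ts)"
    using \<rho> \<sigma> by simp
  moreover have "\<forall>v. \<tau> v \<in> R v"
    using \<rho> \<sigma> by (simp add: \<tau>_def)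
  ultimately show ?case
    by (intro exI[of _ \<tau>] conjI)
qed

text \<open>On the left every occurrence of a variable picks its element independently; on the right
  one valuation serves all of them. Linearity removes the difference. Nonemptiness is also required
  of variables outside \<open>t\<close>, as \<open>\<rho>\<close> must choose a value for them
  too.\<close>

lemma eval_trm_complex_algebra:
  assumes "distinct (var_occs t)" and "\<And>v. R v \<noteq> {}"
  shows "eval_trm (complex_algebra \<A>) R t = {eval_trm \<A> \<rho> t | \<rho>. \<forall>v. \<rho> v \<in> R v}"
  using assms(1)
proof (induction t)
  case (Var x)
  \<comment> \<open>\<open>\<sigma>\<close> supplies the values at variables other than
    \<open>x\<close>.\<close>
  obtain \<sigma> where "\<forall>v. \<sigma> v \<in> R v"
    using choice[of "\<lambda>v a. a \<in> R v"] assms(2) by auto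
  then have "\<exists>\<rho>. a = \<rho> x \<and> (\<forall>v. \<rho> v \<in> R v)" if "a \<in> R x" for a
    using that by (intro exI[of _ "\<sigma>(x := a)"]) simp
  then show ?case
    by auto
next
  case (App f ts)
  have IH: "eval_trm (complex_algebra \<A>) R t = {eval_trm \<A> \<rho> t | \<rho>. \<forall>v. \<rho> v \<in> R v}"
    if "t \<in> set ts" for t
    using that App.prems by (intro App.IH) (simp_all add: distinct_concat_iff)
  \<comment> \<open>The induction hypothesis yields one valuation per argument;
    \<open>common_valuation\<close> then merges them.\<close>
  have "list_all2 (\<in>) xs (map (eval_trm (complex_algebra \<A>) R) ts) \<longleftrightarrow>
      list_all2 (\<lambda>x t. \<exists>\<rho>. (\<forall>v. \<rho> v \<in> R v) \<and> x = eval_trm \<A> \<rho> t) xs ts" for xs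
    by (simp add: list_all2_conv_all_nth IH conj_commute cong: conj_cong)
  also have "\<dots> xs \<longleftrightarrow> (\<exists>\<rho>. (\<forall>v. \<rho> v \<in> R v) \<and> xs = map (eval_trm \<A> \<rho>) ts)" for xs
    using common_valuation[of ts R \<A> xs] App.prems assms(2)
    by (auto simp: list_all2_conv_all_nth)
  finally show ?case
    by (auto simp: complex_algebra_def)
qed

lemma oper_clique_algebra:
  "oper (clique_algebra \<A> T) f ps =
     (oper \<A> f (map fst ps), oper (complex_algebra \<A>) f (map snd ps))"
  by (simp add: clique_algebra_def)

lemma eval_trm_clique_algebra:
  "eval_trm (clique_algebra \<A> T) \<rho> t =
     (eval_trm \<A> (fst \<circ> \<rho>) t, eval_trm (complex_algebra \<A>) (snd \<circ> \<rho>) t)"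
proof (induction t)
  case (App f ts)
  then have "map fst (map (eval_trm (clique_algebra \<A> T) \<rho>) ts) = map (eval_trm \<A> (fst \<circ> \<rho>)) ts"
    and "map snd (map (eval_trm (clique_algebra \<A> T) \<rho>) ts) =
      map (eval_trm (complex_algebra \<A>) (snd \<circ> \<rho>)) ts"
    by (simp_all add: comp_def)
  then show ?case
    by (simp only: eval_trm.simps oper_clique_algebra)
qed simp

text \<open>Two choices of arguments from the same cliques are related by \<open>T\<close> in each
  position, so compatibility relates their results.\<close>

lemma clique_oper:
  assumes "tolerance S \<A> T" and "f \<in> syms S" and "length Xs = arity S f"
    and "\<forall>X\<in>set Xs. clique T X"
  shows "clique T (oper (complex_algebra \<A>) f Xs)"
proof -
  have "(oper \<A> f xs, oper \<A> f ys) \<in> T"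
    if xs: "list_all2 (\<in>) xs Xs" and ys: "list_all2 (\<in>) ys Xs" for xs ys
  proof -
    have T: "(xs ! i, ys ! i) \<in> T" if "i < arity S f" for i
      using that xs ys assms(3,4)
      by (fastforce simp: clique_def list_all2_conv_all_nth all_set_conv_all_nth)
    moreover have "length xs = arity S f" "length ys = arity S f"
      using xs ys assms(3) by (auto dest: list_all2_lengthD)
    moreover have "T \<subseteq> carrier \<A> \<times> carrier \<A>" "compatible S \<A> T"
      using assms(1) by (simp_all add: tolerance_def)
    \<comment> \<open>Each entry is related by \<open>T\<close> to another element, hence lies in
      the carrier.\<close>
    ultimately have "xs \<in> args S f (carrier \<A>)" "ys \<in> args S f (carrier \<A>)"
      by (fastforce simp: args_def in_set_conv_nth)+
    with T show ?thesis
      using \<open>compatible S \<A> T\<close> assms(2) by (simp add: compatible_def)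
  qed
  then show ?thesis
    by (auto simp: clique_def complex_algebra_def)
qed

lemma is_algebra_clique_algebra:
  assumes "tolerance S \<A> T"
  shows "is_algebra S (clique_algebra \<A> T)"
  unfolding is_algebra_def
proof (intro ballI)
  fix f ps
  assume f: "f \<in> syms S" and ps: "ps \<in> args S f (carrier (clique_algebra \<A> T))"
  have *: "length ps = arity S f" "\<forall>p\<in>set ps. fst p \<in> snd p \<and> clique T (snd p)"
    using ps by (auto simp: args_def clique_algebra_def)
  have "clique T (oper (complex_algebra \<A>) f (map snd ps))"
    using * by (intro clique_oper[OF assms f]) auto
  \<comment> \<open>The first components are themselves one choice from the second components, so
    the result stays in the result set.\<close>
  moreover have "list_all2 (\<in>) (map fst ps) (map snd ps)"
    using * by (auto simp: list.rel_map intro!: list.rel_refl_strong)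
  then have "oper \<A> f (map fst ps) \<in> oper (complex_algebra \<A>) f (map snd ps)"
    by (auto simp: complex_algebra_def)
  ultimately show "oper (clique_algebra \<A> T) f ps \<in> carrier (clique_algebra \<A> T)"
    by (simp add: clique_algebra_def)
qed

text \<open>In the second component both sides of \<open>e\<close> become sets of values over the
  same valuations, including when a variable occurs on one side only. Cliques lie in the carrier, so
  each such valuation satisfies \<open>e\<close> in \<open>\<A>\<close>.\<close>

lemma satisfies_clique_algebra:
  assumes "T \<subseteq> carrier \<A> \<times> carrier \<A>" and "satisfies \<A> e" and "linear_identity e"
  shows "satisfies (clique_algebra \<A> T) e"
  unfolding satisfies_def
proof (intro allI impI)
  fix \<rho> :: "'c \<Rightarrow> 'a ext"
  assume "range \<rho> \<subseteq> carrier (clique_algebra \<A> T)"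
  then have \<rho>: "fst (\<rho> v) \<in> snd (\<rho> v)" "clique T (snd (\<rho> v))" for v
    by (auto simp: clique_algebra_def image_subset_iff case_prod_beta)
  have e: "eval_trm \<A> \<sigma> (fst e) = eval_trm \<A> \<sigma> (snd e)" if "\<forall>v. \<sigma> v \<in> snd (\<rho> v)" for \<sigma>
  proof -
    have "range \<sigma> \<subseteq> carrier \<A>"
      using that \<rho>(2) assms(1) by (fastforce simp: clique_def)
    then show ?thesis
      using assms(2) by (simp add: satisfies_def)
  qed
  have "(snd \<circ> \<rho>) v \<noteq> {}" for v
    using \<rho>(1) by auto
  then have complex: "eval_trm (complex_algebra \<A>) (snd \<circ> \<rho>) t =
      {eval_trm \<A> \<sigma> t | \<sigma>. \<forall>v. \<sigma> v \<in> snd (\<rho> v)}" if "distinct (var_occs t)" for t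
    using eval_trm_complex_algebra[OF that, of "snd \<circ> \<rho>"] by simp
  have "eval_trm (complex_algebra \<A>) (snd \<circ> \<rho>) (fst e) =
      eval_trm (complex_algebra \<A>) (snd \<circ> \<rho>) (snd e)"
    using assms(3) e unfolding linear_identity_def by (simp add: complex) metis
  moreover have "eval_trm \<A> (fst \<circ> \<rho>) (fst e) = eval_trm \<A> (fst \<circ> \<rho>) (snd e)"
    using \<rho>(1) by (intro e) simp
  ultimately show "eval_trm (clique_algebra \<A> T) \<rho> (fst e) =
      eval_trm (clique_algebra \<A> T) \<rho> (snd e)"
    by (simp add: eval_trm_clique_algebra)
qed

lemma congruence_kernel_snd:
  assumes "tolerance S \<A> T"
  defines "B \<equiv> carrier (clique_algebra \<A> T)"
  shows "congruence S (clique_algebra \<A> T) {(p, q). p \<in> B \<and> q \<in> B \<and> snd p = snd q}"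
    (is "congruence S ?\<B> ?\<theta>")
proof -
  have "compatible S ?\<B> ?\<theta>"
    unfolding compatible_def
  proof (intro ballI impI)
    fix f ps qs
    assume f: "f \<in> syms S" and ps: "ps \<in> args S f (carrier ?\<B>)"
      and qs: "qs \<in> args S f (carrier ?\<B>)"
      and *: "\<forall>i<arity S f. (ps ! i, qs ! i) \<in> ?\<theta>"
    \<comment> \<open>The second component of a result depends only on the second components of the
      arguments.\<close>
    have "map snd ps = map snd qs"
      using ps qs * by (intro nth_equalityI) (auto simp: args_def)
    then have "snd (oper ?\<B> f ps) = snd (oper ?\<B> f qs)"
      by (simp add: clique_algebra_def)
    then show "(oper ?\<B> f ps, oper ?\<B> f qs) \<in> ?\<theta>"
      using is_algebra_clique_algebra[OF assms(1)] f ps qs by (simp add: is_algebra_def B_def)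
  qed
  then show ?thesis
    by (auto simp: congruence_def tolerance_def refl_on_def sym_def trans_def B_def)
qed

theorem mainTheorem1:
  fixes S :: "'f signature"
    and \<Sigma> :: "('f, 'v) identity set"
    and \<A> :: "('a, 'f) algebra"
    and T :: "('a \<times> 'a) set"
  assumes "\<forall>e\<in>\<Sigma>. is_identity S e \<and> linear_identity e"
    and "\<A> \<in> variety S \<Sigma>"
    and "tolerance S \<A> T"
  shows "\<exists>(\<B> :: ('a ext, 'f) algebra) \<theta> \<phi>.
           \<B> \<in> variety S \<Sigma> \<and>
           congruence S \<B> \<theta> \<and>
           homomorphism S \<B> \<A> \<phi> \<and>
           \<phi> ` carrier \<B> = carrier \<A> \<and>
           T = rel_image \<phi> \<theta>"
proof (intro exI conjI)
  let ?\<B> = "clique_algebra \<A> T"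
  let ?\<theta> = "{(p, q). p \<in> carrier ?\<B> \<and> q \<in> carrier ?\<B> \<and> snd p = snd q}"
  have T: "T \<subseteq> carrier \<A> \<times> carrier \<A>" "refl_on (carrier \<A>) T" "sym T"
    using assms(3) by (simp_all add: tolerance_def)
  show "?\<B> \<in> variety S \<Sigma>"
    using assms(1,2) is_algebra_clique_algebra[OF assms(3)] satisfies_clique_algebra[OF T(1)]
    by (auto simp: variety_def)
  show "congruence S ?\<B> ?\<theta>"
    by (rule congruence_kernel_snd[OF assms(3)])
  \<comment> \<open>By reflexivity the singleton \<open>{a}\<close> is a clique, which gives a
    preimage of \<open>a\<close>.\<close>
  have "a \<in> fst ` carrier ?\<B>" if "a \<in> carrier \<A>" for a
    using that T(2)
    by (intro image_eqI[of _ _ "(a, {a})"]) (auto simp: clique_algebra_def clique_def refl_on_def)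
  moreover have "fst ` carrier ?\<B> \<subseteq> carrier \<A>"
    using T(1) by (fastforce simp: clique_algebra_def clique_def)
  ultimately show "fst ` carrier ?\<B> = carrier \<A>"
    by blast
  then show "homomorphism S ?\<B> \<A> fst"
    by (simp add: homomorphism_def clique_algebra_def)
  show "T = rel_image fst ?\<theta>"
  proof
    show "T \<subseteq> rel_image fst ?\<theta>"
    proof clarify
      fix a b
      assume "(a, b) \<in> T"
      \<comment> \<open>Reflexivity gives the diagonal pairs and symmetry gives
        \<open>(b, a)\<close>; transitivity is not involved.\<close>
      then have "clique T {a, b}"
        using T by (auto simp: clique_def refl_on_def sym_def)
      then have "((a, {a, b}), (b, {a, b})) \<in> ?\<theta>"
        by (simp add: clique_algebra_def)
      then show "(a, b) \<in> rel_image fst ?\<theta>"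
        by (force simp: rel_image_def)
    qed
    show "rel_image fst ?\<theta> \<subseteq> T"
      by (auto simp: rel_image_def clique_algebra_def clique_def)
  qed
qed

end
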